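(* Let $s \in \mathbb{F}_q$ with $s \notin \{0, 1, -1\}$. Then $$\rho\Big(\frac{1+s}{2}\Big)=-1 \quad\text{and}\quad \rho\Big(\frac{1-s}{2}\Big)=1 \qquad ( * )$$ if and only if $g_s(y)$ has no zeros in $\mathbb{F}_q$ but has a zero (in an algebraic closure of $\mathbb{F}_q$) of degree $2$ over $\mathbb{F}_q$. When $( * )$ holds, $g_s(y)$ has the irreducible factorization over $\mathbb{F}_q$ $$g_s(y) = \frac{\tau^2}{2} \prod_{w} \Big(y^2-(1+sw)y+\frac{(s+w)^2}{4}\Big),$$ where the product is over all $w \in \mathbb{F}_q$ for which $\rho((1+w)/2)=\rho((1-w)/2)=-1$; i.e. this identity holds and each displayed quadratic factor is irreducible over $\mathbb{F}_q$.
   Context: $\mathbb{F}_q$ is a finite field with $q$ elements, $q$ a power of an odd prime; $n=(q+1)/2$; for $s\in\mathbb{F}_q$, $g_s(y) := y^n+(1-y)^n-s \in \mathbb{F}_q[y]$. $\rho$ is the quadratic character on $\mathbb{F}_q$ (with $\rho(0)=0$). $\tau = 1$ if $q\equiv 1 \pmod 4$ and $\tau = 2$ if $q \equiv 3 \pmod 4$. The degree of an algebraic element over $\mathbb{F}_q$ is the degree of its minimal polynomial. *)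

theory Defs
  imports
    "HOL-Computational_Algebra.Computational_Algebra"
    "HOL-Library.Cardinality"
    "HOL-Algebra.Algebraic_Closure_Type"
begin

text \<open>
  The finite field with \<open>q\<close> elements is a type \<open>'a\<close> of sort \<open>{field, finite}\<close> with \<open>q = CARD('a)\<close>.
\<close>

definition quad_char :: "'a::field \<Rightarrow> int"
  where "quad_char x = (if x = 0 then 0 else if \<exists>y. x = y ^ 2 then 1 else -1)"

definition g_poly :: "'a::{field,finite} \<Rightarrow> 'a poly"
  where "g_poly s = (let n = (CARD('a) + 1) div 2 in [:0, 1:] ^ n + [:1, -1:] ^ n - [:s:])"

text \<open>Only used for odd \<open>q\<close>, so the second branch is \<open>q\<close> congruent to \<open>3\<close> modulo \<open>4\<close>.\<close>

definition tau :: "nat \<Rightarrow> nat"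
  where "tau q = (if q mod 4 = 1 then 1 else 2)"

text \<open>
  The minimal polynomial over \<open>'a\<close> of an element of the algebraic closure of \<open>'a\<close>, which is
  algebraic over \<open>'a\<close>, so that there is exactly one such polynomial.
\<close>

definition min_poly :: "'a::field alg_closure \<Rightarrow> 'a poly"
  where "min_poly x =
    (THE p. lead_coeff p = 1 \<and> poly (map_poly to_ac p) x = 0 \<and>
            (\<forall>r. r \<noteq> 0 \<and> poly (map_poly to_ac r) x = 0 \<longrightarrow> degree p \<le> degree r))"

definition degree_over :: "'a::field alg_closure \<Rightarrow> nat"
  where "degree_over x = degree (min_poly x)"

definition quad_factor :: "'a::field \<Rightarrow> 'a \<Rightarrow> 'a poly"
  where "quad_factor s w = [:(s + w) ^ 2 / 4, - (1 + s * w), 1:]"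

end

theory Submission
  imports Defs "HOL-Number_Theory.Residues"
begin

text \<open>
  Write \<open>n = (q + 1) / 2\<close> and \<open>\<rho>\<close> for the quadratic character. On the base field \<open>x ^ n = \<rho>(x) x\<close>
  by Euler's criterion, so \<open>g\<^sub>s\<close> is piecewise linear there, and it has a zero exactly when
  \<open>\<rho>((1 + s) / 2) = 1\<close> and \<open>\<rho>((1 - s) / 2) = -1\<close> (lemma \<open>g_poly_root_base_field_iff\<close>).

  Let \<open>y\<close> have degree \<open>2\<close> with trace \<open>T\<close> and norm \<open>N\<close>. Its other conjugate is \<open>y ^ q\<close>, so
  \<open>(y ^ n)\<^sup>2 = y ^ (q + 1) = N\<close>, and likewise \<open>((1 - y) ^ n)\<^sup>2 = 1 - T + N\<close>. If \<open>g\<^sub>s\<close> vanishes at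
  \<open>y\<close>, then \<open>y ^ n\<close> and \<open>(1 - y) ^ n\<close> have sum \<open>s\<close> and known difference of squares, hence they are
  \<open>(s + w) / 2\<close> and \<open>(s - w) / 2\<close> for some \<open>w\<close> in the base field, and \<open>y\<close> is a zero of
  \<open>quad_factor s w\<close>. It remains to see which \<open>w\<close> occur. A zero \<open>y\<close> of \<open>quad_factor s w\<close> satisfies
  \<open>(y + (s + w) / 2)\<^sup>2 = (1 + s) (1 + w) y\<close>, and taking \<open>n\<close>-th powers determines the sign:
  \<open>y ^ n = \<rho>((1 + s) (1 + w)) (s + w) / 2\<close> (lemma \<open>half_power_of_square_norm\<close>). The map
  \<open>y \<mapsto> 1 - y\<close> replaces \<open>w\<close> by \<open>-w\<close> and gives the sign of \<open>(1 - y) ^ n\<close>. So both signs are positive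
  iff \<open>\<rho>(1 + w) = \<rho>(1 - w) = \<rho>(1 + s)\<close>, while irreducibility of the quadratic, whose discriminant
  is \<open>(1 - s\<^sup>2) (1 - w\<^sup>2)\<close>, demands \<open>\<rho>(1 - s) = -\<rho>(1 + s)\<close>. One of the two resulting cases for \<open>s\<close>
  is that of zeros in the base field, and the other is the condition of the theorem.

  In that case every \<open>w\<close> of the product contributes an irreducible divisor of \<open>g\<^sub>s\<close>. Their number
  is \<open>(q - \<rho>(-1)) / 4\<close> by a Jacobi sum (lemma \<open>card_nonsquare_pairs_sum_one\<close>). It is positive,
  which gives a zero of degree \<open>2\<close>, and twice the number is the degree of \<open>g\<^sub>s\<close>, so that the
  factorization is complete.
\<close>

section \<open>Finite fields inside their algebraic closure\<close>

lemma finite_field_power_card: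
  fixes x :: "'a::{field,finite}"
  shows "x ^ CARD('a) = x"
proof (cases "x = 0")
  case False
  have "bij_betw (\<lambda>y. x * y) (UNIV - {0}) (UNIV - {0})"
    by (rule bij_betwI[where g = "\<lambda>y. y / x"]) (use False in auto)
  then have "(\<Prod>y\<in>UNIV - {0}. x * y) = \<Prod>(UNIV - {0})"
    using prod.reindex_bij_betw[of "\<lambda>y. x * y" _ _ "\<lambda>y. y"] by simp
  then have "x ^ (CARD('a) - 1) * \<Prod>(UNIV - {0}) = 1 * \<Prod>(UNIV - {0 :: 'a})"
    by (simp add: prod.distrib card_Diff_subset)
  then have "x ^ (CARD('a) - 1) = 1"
    by (subst (asm) mult_right_cancel) auto
  then have "x * x ^ (CARD('a) - 1) = x" by simp
  then show ?thesis
    using power_Suc[of x "CARD('a) - 1"] zero_less_card_finite[where 'a='a] by simp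
qed simp

text \<open>The polynomial \<open>X ^ q - X\<close> has at most \<open>q\<close> zeros, and the base field already supplies \<open>q\<close>.\<close>

lemma power_card_fixed_imp_base_field:
  fixes z :: "'a::{field,finite} alg_closure"
  assumes "z ^ CARD('a) = z"
  shows "z \<in> range to_ac"
proof -
  define P :: "'a alg_closure poly" where "P = monom 1 CARD('a) - monom 1 1"
  have two: "2 \<le> CARD('a)"
    using card_mono[of "UNIV :: 'a set" "{0, 1}"] by simp
  then have "coeff P CARD('a) = 1" by (simp add: P_def)
  then have P0: "P \<noteq> 0" by auto
  have degP: "degree P \<le> CARD('a)"
    unfolding P_def using two by (intro degree_diff_le) (auto simp: degree_monom_eq)
  have root: "poly P x = x ^ CARD('a) - x" for x
    by (simp add: P_def poly_monom)
  have sub: "range to_ac \<subseteq> {x. poly P x = 0}"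
    by (auto simp: root simp flip: to_ac_power simp: finite_field_power_card)
  have "card {x. poly P x = 0} \<le> card (range (to_ac :: 'a \<Rightarrow> _))"
    using card_poly_roots_bound[OF P0] degP by (simp add: card_image[OF inj_to_ac])
  then have "range to_ac = {x. poly P x = 0}"
    using sub poly_roots_finite[OF P0] by (intro card_subset_eq card_seteq) auto
  then show ?thesis using assms root by auto
qed

lemma two_neq_zero_odd_card:
  assumes "odd CARD('a::{field,finite})"
  shows "(2 :: 'a) \<noteq> 0"
proof
  assume "(2 :: 'a) = 0"
  then have "of_nat 2 = (0 :: 'a)" by simp
  then have "CHAR('a) dvd 2" by (simp only: of_nat_eq_0_iff_char_dvd)
  moreover have "CHAR('a) \<noteq> 1" by simp
  ultimately have "CHAR('a) = 2"
    using prime_nat_iff two_is_prime_nat by blast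
  then show False using assms CHAR_dvd_CARD[where 'a='a] by simp
qed

lemma four_neq_zero_odd_card:
  assumes "odd CARD('a::{field,finite})"
  shows "(4 :: 'a) \<noteq> 0"
  using two_neq_zero_odd_card[OF assms] by (metis mult_2 mult_eq_0_iff numeral_Bit0)

lemma half_power_card:
  assumes "odd CARD('a::{field,finite})"
  shows "CARD('a) = Suc (2 * (CARD('a) div 2))" "(CARD('a) + 1) div 2 = Suc (CARD('a) div 2)"
  using assms by presburger+

section \<open>The quadratic character\<close>

lemma quad_char_0 [simp]: "quad_char 0 = 0"
  and quad_char_eq_0_iff [simp]: "quad_char x = 0 \<longleftrightarrow> x = 0"
  by (auto simp: quad_char_def)

lemma quad_char_cases: "quad_char x \<in> {-1, 0, 1}"
  by (auto simp: quad_char_def)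

lemma quad_char_square [simp]: "x \<noteq> 0 \<Longrightarrow> quad_char (x ^ 2) = 1"
  by (auto simp: quad_char_def)

lemma quad_char_eq_neg_one_iff: "quad_char x = -1 \<longleftrightarrow> (\<forall>y. x \<noteq> y ^ 2)"
  by (auto simp: quad_char_def)

text \<open>Euler's criterion. A square root \<open>u\<close> of \<open>x\<close> in the closure satisfies
  \<open>u ^ q = u * x ^ ((q - 1) / 2)\<close>, and \<open>u ^ q = u\<close> decides whether \<open>u\<close> lies in the base field.\<close>

lemma euler_criterion_finite_field:
  fixes x :: "'a::{field,finite}"
  assumes odd: "odd CARD('a)"
  shows "of_int (quad_char x) = x ^ (CARD('a) div 2)"
proof -
  define m where "m = CARD('a) div 2"
  have q: "CARD('a) = Suc (2 * m)" using half_power_card(1)[OF odd] by (simp add: m_def)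
  have m0: "m > 0"
    using card_mono[of "UNIV :: 'a set" "{0, 1}"] q by simp
  have fermat: "z ^ (2 * m) = 1" if "z \<noteq> 0" for z :: 'a
    using finite_field_power_card[of z] that by (simp add: q)
  have "of_int (quad_char x) = x ^ m"
  proof (cases "x = 0")
    case True
    then show ?thesis using m0 by simp
  next
    case x: False
    show ?thesis
    proof (cases "\<exists>y. x = y ^ 2")
      case True
      then obtain y where "x = y ^ 2" by blast
      then show ?thesis using x fermat[of y] by (simp add: power_mult)
    next
      case False
      obtain u :: "'a alg_closure" where u: "u ^ 2 = to_ac x"
        using nth_root_exists[of 2 "to_ac x"] by auto
      have "(x ^ m) ^ 2 = 1" using fermat[OF x] by (simp add: power_mult mult.commute)
      then have "x ^ m = 1 \<or> x ^ m = -1" by (simp add: power2_eq_1_iff)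
      moreover have "x ^ m \<noteq> 1"
      proof
        assume "x ^ m = 1"
        then have "u ^ CARD('a) = u"
          by (simp add: q power_mult u flip: to_ac_power)
        then obtain v where "u = to_ac v" using power_card_fixed_imp_base_field by auto
        then have "x = v ^ 2" using u by (simp flip: to_ac_power)
        then show False using False by blast
      qed
      ultimately show ?thesis using x False by (simp add: quad_char_def)
    qed
  qed
  then show ?thesis by (simp add: m_def)
qed

lemma power_half_Suc_card:
  fixes x :: "'a::{field,finite}"
  assumes "odd CARD('a)"
  shows "x ^ ((CARD('a) + 1) div 2) = of_int (quad_char x) * x"
  using euler_criterion_finite_field[OF assms, of x]
  by (simp add: half_power_card(2)[OF assms] del: One_nat_def Suc_1)

lemma of_int_sign_eq_iff:
  fixes x :: "'a::{field,finite}"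
  assumes "odd CARD('a)" and "a \<in> {-1, 0, 1}" "b \<in> {-1, 0, 1}"
    and "of_int a = (of_int b :: 'a)"
  shows "a = b"
proof -
  have "(1 :: 'a) \<noteq> -1" "(-1 :: 'a) \<noteq> 1"
    using two_neq_zero_odd_card[OF assms(1)] by (metis add.right_inverse one_add_one)+
  then show ?thesis using assms(2-) by auto
qed

lemma quad_char_mult:
  fixes x y :: "'a::{field,finite}"
  assumes "odd CARD('a)"
  shows "quad_char (x * y) = quad_char x * quad_char y"
proof (rule of_int_sign_eq_iff[OF assms])
  show "quad_char x * quad_char y \<in> {-1, 0, 1}"
    using quad_char_cases[of x] quad_char_cases[of y] by auto
  show "of_int (quad_char (x * y)) = (of_int (quad_char x * quad_char y) :: 'a)"
    by (simp add: euler_criterion_finite_field[OF assms] power_mult_distrib)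
qed (rule quad_char_cases)

lemma quad_char_minus_one:
  assumes "odd CARD('a::{field,finite})"
  shows "quad_char (-1 :: 'a) = (if CARD('a) mod 4 = 1 then 1 else -1)"
proof (rule of_int_sign_eq_iff[OF assms quad_char_cases])
  have "even (CARD('a) div 2) \<longleftrightarrow> CARD('a) mod 4 = 1" using assms by presburger
  then show "of_int (quad_char (-1 :: 'a)) =
      (of_int (if CARD('a) mod 4 = 1 then 1 else -1) :: 'a)"
    by (simp add: euler_criterion_finite_field[OF assms])
qed auto

lemma quad_char_halves:
  fixes u v :: "'a::{field,finite}"
  assumes "odd CARD('a)"
  shows "quad_char (u * v) = quad_char (u / 2) * quad_char (v / 2)"
proof -
  have "quad_char (u * v) = quad_char (2 ^ 2 * ((u / 2) * (v / 2)))"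
    using two_neq_zero_odd_card[OF assms] four_neq_zero_odd_card[OF assms]
    by (simp add: power2_eq_square)
  then show ?thesis
    by (simp only: quad_char_mult[OF assms] quad_char_square[OF two_neq_zero_odd_card[OF assms]]
        mult_1 simp_thms)
qed

section \<open>Counting non-squares that sum to one\<close>

text \<open>There are at most \<open>(q - 1) / 2\<close> solutions of \<open>x ^ ((q - 1) / 2) = 1\<close>, so some \<open>c\<close> is a
  non-square; substituting \<open>c x\<close> for \<open>x\<close> then negates the sum.\<close>

lemma sum_quad_char:
  assumes odd: "odd CARD('a::{field,finite})"
  shows "(\<Sum>x\<in>(UNIV :: 'a set). quad_char x) = 0"
proof -
  define m where "m = CARD('a) div 2"
  have q: "CARD('a) = Suc (2 * m)" using half_power_card(1)[OF odd] by (simp add: m_def)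
  have m0: "m > 0"
    using card_mono[of "UNIV :: 'a set" "{0, 1}"] q by simp
  obtain c :: 'a where c: "quad_char c = -1"
  proof (rule ccontr)
    assume "\<not> thesis"
    then have no: "quad_char x \<noteq> -1" for x :: 'a using that by blast
    define P :: "'a poly" where "P = monom 1 m - 1"
    have "coeff P m = 1" using m0 by (simp add: P_def)
    then have P0: "P \<noteq> 0" by auto
    have degP: "degree P \<le> m"
      unfolding P_def by (intro degree_diff_le) (auto simp: degree_monom_eq)
    have "UNIV - {0} \<subseteq> {x. poly P x = 0}"
    proof
      fix x :: 'a assume "x \<in> UNIV - {0}"
      then have "quad_char x = 1" using no[of x] quad_char_cases[of x] by auto
      then have "x ^ m = 1"
        using euler_criterion_finite_field[OF odd, of x] by (simp add: m_def)
      then show "x \<in> {x. poly P x = 0}" by (simp add: P_def poly_monom)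
    qed
    then have "card (UNIV - {0 :: 'a}) \<le> m"
      using card_mono[OF poly_roots_finite[OF P0]] card_poly_roots_bound[OF P0] degP
      by (meson le_trans)
    then show False using q m0 by (simp add: card_Diff_subset)
  qed
  then have c0: "c \<noteq> 0" by auto
  have "bij (\<lambda>x. c * x)"
    by (rule bij_betwI[where g = "\<lambda>y. y / c"]) (use c0 in auto)
  then have "(\<Sum>x\<in>UNIV. quad_char (c * x)) = (\<Sum>x\<in>(UNIV :: 'a set). quad_char x)"
    by (rule sum.reindex_bij_betw)
  moreover have "(\<Sum>x\<in>UNIV. quad_char (c * x)) = - (\<Sum>x\<in>(UNIV :: 'a set). quad_char x)"
    by (simp add: quad_char_mult[OF odd] c sum_negf)
  ultimately show ?thesis by simp
qed

text \<open>For \<open>x \<noteq> 0\<close> the value \<open>x (1 - x)\<close> is \<open>1 / x - 1\<close> times a square, and \<open>1 / x - 1\<close> runs over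
  all field elements except \<open>-1\<close>.\<close>

lemma jacobi_sum_quad_char:
  assumes odd: "odd CARD('a::{field,finite})"
  shows "(\<Sum>x\<in>(UNIV :: 'a set). quad_char x * quad_char (1 - x)) = - quad_char (-1 :: 'a)"
proof -
  have "(\<Sum>x\<in>(UNIV :: 'a set). quad_char x * quad_char (1 - x)) =
      (\<Sum>x\<in>UNIV - {0 :: 'a}. quad_char x * quad_char (1 - x))"
    by (rule sum.mono_neutral_right) auto
  also have "\<dots> = (\<Sum>x\<in>UNIV - {0 :: 'a}. quad_char (1 / x - 1))"
  proof (rule sum.cong)
    fix x :: 'a assume "x \<in> UNIV - {0}"
    then have x: "x \<noteq> 0" by simp
    then have "x * (1 - x) = x ^ 2 * (1 / x - 1)"
      by (simp add: power2_eq_square field_simps)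
    then show "quad_char x * quad_char (1 - x) = quad_char (1 / x - 1)"
      using x by (metis mult_1 quad_char_mult[OF odd] quad_char_square)
  qed simp
  also have "\<dots> = (\<Sum>t\<in>UNIV - {-1 :: 'a}. quad_char t)"
  proof (rule sum.reindex_bij_betw)
    show "bij_betw (\<lambda>x :: 'a. 1 / x - 1) (UNIV - {0}) (UNIV - {-1})"
      by (rule bij_betwI[where g = "\<lambda>t. 1 / (t + 1)"]) (auto simp: add_eq_0_iff2)
  qed
  also have "\<dots> = - quad_char (-1 :: 'a)"
    using sum_quad_char[OF odd] by (simp add: sum_diff1)
  finally show ?thesis .
qed

text \<open>The summand \<open>(1 - \<rho>(x)) (1 - \<rho>(1 - x))\<close> is \<open>4\<close> on the set being counted and \<open>0\<close> elsewhere,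
  also at \<open>x = 0\<close> and \<open>x = 1\<close>.\<close>

lemma card_nonsquare_pairs_sum_one:
  assumes odd: "odd CARD('a::{field,finite})"
  shows "4 * int (card {w :: 'a. quad_char ((1 + w) / 2) = -1 \<and> quad_char ((1 - w) / 2) = -1})
    = int CARD('a) - quad_char (-1 :: 'a)"
proof -
  note two = two_neq_zero_odd_card[OF odd]
  let ?X = "{x :: 'a. quad_char x = -1 \<and> quad_char (1 - x) = -1}"
  have half: "(1 - w) / 2 = 1 - (1 + w) / 2" for w :: 'a
    using two by (simp add: field_simps)
  have inv: "2 * ((1 + w) / 2) - 1 = w" for w :: 'a
    using two by (simp del: distrib_left_numeral)
  have "bij_betw (\<lambda>w. (1 + w) / 2)
      {w. quad_char ((1 + w) / 2) = -1 \<and> quad_char ((1 - w) / 2) = -1} ?X"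
    by (rule bij_betwI[where g = "\<lambda>x. 2 * x - 1"]) (use two in \<open>auto simp: half inv simp del: distrib_left_numeral times_divide_eq_right\<close>)
  then have card: "card {w :: 'a. quad_char ((1 + w) / 2) = -1 \<and> quad_char ((1 - w) / 2) = -1}
      = card ?X"
    by (rule bij_betw_same_card)
  have refl: "(\<Sum>x\<in>(UNIV :: 'a set). quad_char (1 - x)) = (\<Sum>x\<in>(UNIV :: 'a set). quad_char x)"
    by (rule sum.reindex_bij_betw, rule bij_betwI[where g = "\<lambda>x. 1 - x"]) auto
  have "4 * int (card ?X) = (\<Sum>x\<in>(UNIV :: 'a set). if x \<in> ?X then 4 else 0)"
    by (simp add: sum.If_cases)
  also have "\<dots> = (\<Sum>x\<in>(UNIV :: 'a set). (1 - quad_char x) * (1 - quad_char (1 - x)))"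
  proof (rule sum.cong)
    fix x :: 'a
    have one: "quad_char (1 :: 'a) = 1" using quad_char_square[of "1 :: 'a"] by simp
    consider "x = 0" | "x = 1" | "x \<noteq> 0" "1 - x \<noteq> 0" by force
    then show "(if x \<in> ?X then 4 else 0) = (1 - quad_char x) * (1 - quad_char (1 - x))"
    proof cases
      case 3
      then show ?thesis using quad_char_cases[of x] quad_char_cases[of "1 - x"]
        by (auto simp del: right_minus_eq)
    qed (simp_all add: one)
  qed simp
  also have "\<dots> = (\<Sum>x\<in>(UNIV :: 'a set).
      1 - quad_char x - quad_char (1 - x) + quad_char x * quad_char (1 - x))"
    by (simp add: algebra_simps)
  also have "\<dots> = int CARD('a) - quad_char (-1 :: 'a)"
    by (simp add: sum.distrib sum_subtractf refl sum_quad_char[OF odd] jacobi_sum_quad_char[OF odd])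
  finally show ?thesis by (simp add: card)
qed

section \<open>Elements of degree two in the closure\<close>

abbreviation eval_ac :: "'a::field poly \<Rightarrow> 'a alg_closure \<Rightarrow> 'a alg_closure"
  where "eval_ac p y \<equiv> poly (map_poly to_ac p) y"

lemma eval_ac_pCons [simp]: "eval_ac (pCons c p) y = to_ac c + y * eval_ac p y"
  by (simp add: map_poly_pCons)

lemma eval_ac_add [simp]: "eval_ac (p + r) y = eval_ac p y + eval_ac r y"
proof -
  have "map_poly to_ac (p + r) = map_poly to_ac p + map_poly to_ac r"
    by (rule poly_eqI) (simp add: coeff_map_poly)
  then show ?thesis by simp
qed

lemma eval_ac_minus [simp]: "eval_ac (- p) y = - eval_ac p y"
  using eval_ac_add[of p "- p" y] by (simp add: eq_neg_iff_add_eq_0 add.commute del: eval_ac_add)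

lemma eval_ac_diff [simp]: "eval_ac (p - r) y = eval_ac p y - eval_ac r y"
  using eval_ac_add[of p "- r" y] by simp

lemma eval_ac_smult [simp]: "eval_ac (smult c p) y = to_ac c * eval_ac p y"
  by (induction p) (auto simp: algebra_simps)

lemma eval_ac_mult [simp]: "eval_ac (p * r) y = eval_ac p y * eval_ac r y"
  by (induction p) (auto simp: algebra_simps)

lemma eval_ac_power [simp]: "eval_ac (p ^ n) y = eval_ac p y ^ n"
  by (induction n) auto

lemma poly_degree_eq_2E:
  assumes "degree m = 2" and "lead_coeff m = 1"
  obtains c b :: "'a::field" where "m = [:c, b, 1:]"
proof -
  have "m = [:coeff m 0, coeff m 1, 1:]"
    using assms by (intro poly_eqI)
      (auto simp: coeff_pCons coeff_eq_0 numeral_2_eq_2 split: nat.split)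
  then show ?thesis using that by blast
qed

lemma degree_lt_2_no_root:
  assumes "y \<notin> range to_ac" and "degree r < 2" and "eval_ac r y = 0"
  shows "r = 0"
proof -
  obtain a b where r: "r = [:a, b:]"
    using degree1_coeffs[of r] degree_eq_zeroE[of r] assms(2)
    by (metis One_nat_def less_2_cases pCons_0_0)
  have "b = 0"
  proof (rule ccontr)
    assume "b \<noteq> 0"
    then have "y = to_ac (- a / b)" using assms(3) by (simp add: r field_simps add_eq_0_iff)
    then show False using assms(1) by blast
  qed
  then show ?thesis using assms(3) by (simp add: r)
qed

text \<open>A remainder modulo the quadratic has degree at most \<open>1\<close>, and such a polynomial, unless it is
  \<open>0\<close>, has its zeros in the base field. Hence the quadratic is prime and is the minimal polynomial
  of \<open>y\<close>.\<close>

lemma quadratic_root_eval_zero_iff: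
  assumes "y \<notin> range to_ac" and "eval_ac [:c, b, 1:] y = 0"
  shows "eval_ac p y = 0 \<longleftrightarrow> [:c, b, 1:] dvd p"
proof
  let ?m = "[:c, b, 1:]"
  assume p: "eval_ac p y = 0"
  have "eval_ac p y = eval_ac (?m * (p div ?m) + p mod ?m) y"
    by (simp only: mult_div_mod_eq)
  also have "\<dots> = eval_ac (p mod ?m) y"
    by (simp only: eval_ac_add eval_ac_mult assms(2) mult_zero_left add_0)
  finally have "eval_ac (p mod ?m) y = 0" using p by simp
  moreover have "degree (p mod ?m) < 2"
    using degree_mod_less[of ?m p] by auto
  ultimately show "?m dvd p" using degree_lt_2_no_root[OF assms(1)] by auto
next
  assume "[:c, b, 1:] dvd p"
  then obtain t where "p = [:c, b, 1:] * t" by (elim dvdE)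
  then show "eval_ac p y = 0" by (simp only: eval_ac_mult assms(2) mult_zero_left)
qed

lemma quadratic_root_prime_elem:
  assumes "y \<notin> range to_ac" and "eval_ac [:c, b, 1:] y = 0"
  shows "prime_elem [:c, b, 1:]"
proof (rule prime_elemI)
  show "\<not> [:c, b, 1:] dvd 1"
    unfolding quadratic_root_eval_zero_iff[OF assms, symmetric] by simp
  show "[:c, b, 1:] dvd p \<or> [:c, b, 1:] dvd r" if "[:c, b, 1:] dvd p * r" for p r
    using that
    by (simp only: quadratic_root_eval_zero_iff[OF assms, symmetric] eval_ac_mult mult_eq_0_iff)
qed simp

lemma min_poly_eqI:
  assumes "lead_coeff m = 1" and "eval_ac m y = 0"
    and least: "\<And>r. r \<noteq> 0 \<Longrightarrow> eval_ac r y = 0 \<Longrightarrow> degree m \<le> degree r"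
  shows "min_poly y = m"
  unfolding min_poly_def
proof (rule the_equality)
  fix p
  assume p: "lead_coeff p = 1 \<and> eval_ac p y = 0 \<and>
    (\<forall>r. r \<noteq> 0 \<and> eval_ac r y = 0 \<longrightarrow> degree p \<le> degree r)"
  have "p \<noteq> 0" "m \<noteq> 0" using p assms(1) by auto
  then have deg: "degree p = degree m" using p assms(2) least by (meson antisym)
  show "p = m"
  proof (rule ccontr)
    assume "p \<noteq> m"
    then have "degree m \<le> degree (p - m)" using p assms(2) by (intro least) auto
    moreover have "coeff (p - m) (degree m) = 0" using p deg assms(1) by simp
    moreover have "degree (p - m) \<le> degree m" using deg degree_diff_le by (metis order_refl)
    ultimately have "p - m = 0" by (metis antisym leading_coeff_0_iff)
    then show False using \<open>p \<noteq> m\<close> by simp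
  qed
qed (use assms in auto)

lemma min_poly_props:
  assumes "r \<noteq> 0" and "eval_ac r y = 0"
  shows "lead_coeff (min_poly y) = 1" and "eval_ac (min_poly y) y = 0"
    and "\<And>t. t \<noteq> 0 \<Longrightarrow> eval_ac t y = 0 \<Longrightarrow> degree (min_poly y) \<le> degree t"
proof -
  obtain p where p: "p \<noteq> 0" "eval_ac p y = 0"
    and least: "\<And>t. t \<noteq> 0 \<and> eval_ac t y = 0 \<Longrightarrow> degree p \<le> degree t"
    using ex_has_least_nat[of "\<lambda>t. t \<noteq> 0 \<and> eval_ac t y = 0" r degree] assms by blast
  let ?m = "smult (inverse (lead_coeff p)) p"
  have "min_poly y = ?m"
    by (rule min_poly_eqI) (use p least in auto)
  then show "lead_coeff (min_poly y) = 1" "eval_ac (min_poly y) y = 0"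
    "\<And>t. t \<noteq> 0 \<Longrightarrow> eval_ac t y = 0 \<Longrightarrow> degree (min_poly y) \<le> degree t"
    using p least by auto
qed

lemma degree_over_quadratic_root:
  assumes "y \<notin> range to_ac" and "eval_ac [:c, b, 1:] y = 0"
  shows "degree_over y = 2"
proof -
  have "min_poly y = [:c, b, 1:]"
  proof (rule min_poly_eqI)
    fix r assume "r \<noteq> 0" "eval_ac r y = 0"
    then show "degree [:c, b, 1:] \<le> degree r"
      by (intro dvd_imp_degree_le) (simp_all add: quadratic_root_eval_zero_iff[OF assms] del: eval_ac_pCons)
  qed (use assms in simp_all)
  then show ?thesis by (simp add: degree_over_def)
qed

lemma degree_over_eq_2E:
  assumes "r \<noteq> 0" and "eval_ac r y = 0" and "degree_over y = 2"
  obtains c b where "eval_ac [:c, b, 1:] y = 0" and "y \<notin> range to_ac"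
proof -
  note props = min_poly_props[OF assms(1,2)]
  obtain c b where m: "min_poly y = [:c, b, 1:]"
    using poly_degree_eq_2E[of "min_poly y"] assms(3) props(1) by (auto simp: degree_over_def)
  have "y \<notin> range to_ac"
  proof
    assume "y \<in> range to_ac"
    then obtain a where "y = to_ac a" by blast
    then show False using props(3)[of "[:-a, 1:]"] m by simp
  qed
  then show ?thesis using that props(2) m by metis
qed

text \<open>The Frobenius map permutes the zeros of a polynomial over the base field and fixes only the
  base field, so it sends \<open>y\<close> to the other zero of its quadratic.\<close>

lemma frobenius_quadratic_root:
  fixes y :: "'a::{field,finite} alg_closure"
  assumes card: "CARD('a) = CHAR('a) ^ k"
    and y: "y \<notin> range to_ac" and root: "y ^ 2 = to_ac T * y - to_ac N"
  shows "y ^ CARD('a) = to_ac T - y"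
proof -
  have pr: "prime CHAR('a)" by (simp add: prime_CHAR_semidom finite_imp_CHAR_pos)
  let ?q = "CARD('a)"
  have add: "(u + v) ^ ?q = u ^ ?q + v ^ ?q" for u v :: "'a alg_closure"
    by (rule freshmans_dream'[where n = k]) (use pr card in auto)
  have base: "to_ac a ^ ?q = (to_ac a :: 'a alg_closure)" for a :: 'a
    by (simp add: finite_field_power_card flip: to_ac_power)
  have "(y ^ 2 + to_ac N) ^ ?q = (to_ac T * y) ^ ?q" by (simp add: root)
  then have "(y ^ ?q) ^ 2 + to_ac N = to_ac T * y ^ ?q"
    by (simp add: add base power_mult_distrib flip: power_mult) (simp add: mult.commute)
  moreover have "(y ^ ?q - y) * (y ^ ?q - (to_ac T - y)) =
      ((y ^ ?q) ^ 2 + to_ac N - to_ac T * y ^ ?q) - (y ^ 2 - (to_ac T * y - to_ac N))"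
    by (simp add: power2_eq_square algebra_simps)
  ultimately have "(y ^ ?q - y) * (y ^ ?q - (to_ac T - y)) = 0"
    using root by simp
  moreover have "y ^ ?q \<noteq> y" using power_card_fixed_imp_base_field y by blast
  ultimately show ?thesis by simp
qed

text \<open>The equation of \<open>y\<close> says \<open>(y + a)\<^sup>2 = (T + 2 a) y\<close>. Raising it to the power \<open>(q + 1) / 2\<close> turns
  the left side into the norm \<open>a (T + 2 a)\<close> of \<open>y + a\<close>, and the constant \<open>T + 2 a\<close> into
  \<open>\<rho>(T + 2 a) (T + 2 a)\<close>.\<close>

lemma half_power_of_square_norm:
  fixes y :: "'a::{field,finite} alg_closure"
  assumes odd: "odd CARD('a)" and card: "CARD('a) = CHAR('a) ^ k"
    and y: "y \<notin> range to_ac" and root: "y ^ 2 = to_ac T * y - to_ac (a ^ 2)"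
  shows "y ^ ((CARD('a) + 1) div 2) = to_ac (of_int (quad_char (T + 2 * a)) * a)"
proof -
  define n where "n = (CARD('a) + 1) div 2"
  define c where "c = T + 2 * a"
  let ?A = "to_ac a :: 'a alg_closure"
  have n2: "2 * n = Suc CARD('a)" using odd by (simp add: n_def)
  have sq: "(y + ?A) ^ 2 = to_ac c * y"
    using root unfolding c_def by (simp add: power2_eq_square algebra_simps)
  have c0: "c \<noteq> 0"
  proof
    assume "c = 0"
    then have "y = to_ac (- a)" using sq by (simp add: eq_neg_iff_add_eq_0)
    then show False using y by blast
  qed
  have "y + ?A \<notin> range to_ac"
  proof
    assume "y + ?A \<in> range to_ac"
    then obtain b where "y + ?A = to_ac b" by blast
    then have "y = to_ac (b - a)" by (simp add: algebra_simps)
    then show False using y by blast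
  qed
  moreover have "(y + ?A) ^ 2 = to_ac (T + 2 * a) * (y + ?A) - to_ac (a * (T + 2 * a))"
    using sq by (simp add: c_def algebra_simps)
  ultimately have "(y + ?A) ^ CARD('a) = to_ac (T + 2 * a) - (y + ?A)"
    by (rule frobenius_quadratic_root[OF card])
  then have "(y + ?A) ^ (2 * n) = (y + ?A) * (to_ac c - (y + ?A))"
    by (simp add: n2 c_def)
  also have "\<dots> = to_ac (a * c)"
    using sq by (simp add: power2_eq_square algebra_simps)
  finally have "to_ac (a * c) = (to_ac c * y) ^ n" by (simp add: power_mult sq)
  also have "\<dots> = to_ac (of_int (quad_char c) * c) * y ^ n"
    using power_half_Suc_card[OF odd, of c]
    by (simp add: power_mult_distrib n_def flip: to_ac_power)
  finally have a: "?A = to_ac (of_int (quad_char c)) * y ^ n"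
    using c0 by (simp add: field_simps)
  have "quad_char c = 1 \<or> quad_char c = -1" using c0 quad_char_cases[of c] by auto
  then have "y ^ n = to_ac (of_int (quad_char c) * a)" using a by auto
  then show ?thesis by (simp add: n_def c_def)
qed

lemma one_minus_in_base_field_iff: "1 - y \<in> range to_ac \<longleftrightarrow> y \<in> range to_ac"
proof -
  have refl: "1 - z \<in> range to_ac" if "z \<in> range to_ac" for z
    using that by (metis (no_types, lifting) imageE rangeI to_ac_1 to_ac_diff)
  show ?thesis using refl[of y] refl[of "1 - y"] by auto
qed

section \<open>The quadratic factors\<close>

lemma eval_ac_g_poly:
  fixes y :: "'a::{field,finite} alg_closure"
  shows "eval_ac (g_poly s) y =
    y ^ ((CARD('a) + 1) div 2) + (1 - y) ^ ((CARD('a) + 1) div 2) - to_ac s"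
  by (simp add: g_poly_def Let_def)

lemma poly_g_poly:
  fixes y :: "'a::{field,finite}"
  assumes "odd CARD('a)"
  shows "poly (g_poly s) y = of_int (quad_char y) * y + of_int (quad_char (1 - y)) * (1 - y) - s"
  using power_half_Suc_card[OF assms, of y] power_half_Suc_card[OF assms, of "1 - y"]
  by (simp add: g_poly_def Let_def)

text \<open>At \<open>y\<close> in the base field \<open>g\<^sub>s\<close> takes one of the values \<open>\<plusminus>1 - s\<close> and \<open>\<plusminus>(2 y - 1) - s\<close>, the latter exactly
  when \<open>y\<close> and \<open>1 - y\<close> have opposite characters.\<close>

lemma g_poly_root_base_field_iff:
  fixes s :: "'a::{field,finite}"
  assumes odd: "odd CARD('a)" and s: "s \<notin> {0, 1, -1}"
  shows "(\<exists>y. poly (g_poly s) y = 0) \<longleftrightarrow>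
    quad_char ((1 + s) / 2) = 1 \<and> quad_char ((1 - s) / 2) = -1"
proof
  note two = two_neq_zero_odd_card[OF odd]
  assume "\<exists>y. poly (g_poly s) y = 0"
  then obtain y where y: "of_int (quad_char y) * y + of_int (quad_char (1 - y)) * (1 - y) - s = 0"
    by (auto simp: poly_g_poly[OF odd])
  have one: "quad_char (1 :: 'a) = 1" using quad_char_square[of "1 :: 'a"] by simp
  have y01: "y \<noteq> 0" "1 - y \<noteq> 0" using y s one by auto
  consider "quad_char y = 1" "quad_char (1 - y) = 1" | "quad_char y = -1" "quad_char (1 - y) = -1"
    | "quad_char y = 1" "quad_char (1 - y) = -1" | "quad_char y = -1" "quad_char (1 - y) = 1"
    using quad_char_cases[of y] quad_char_cases[of "1 - y"] y01
    by (auto simp del: right_minus_eq)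
  then show "quad_char ((1 + s) / 2) = 1 \<and> quad_char ((1 - s) / 2) = -1"
  proof cases
    case 1
    then have "s = 1" using y by simp
    then show ?thesis using s by simp
  next
    case 2
    then have "s = -1" using y by simp
    then show ?thesis using s by simp
  next
    case 3
    then have "s = 2 * y - 1" using y by (simp add: algebra_simps)
    then have "(1 + s) / 2 = y" "(1 - s) / 2 = 1 - y" using two by (auto simp: field_simps)
    then show ?thesis using 3 by metis
  next
    case 4
    then have "s = 1 - 2 * y" using y by (simp add: algebra_simps)
    then have "(1 + s) / 2 = 1 - y" "(1 - s) / 2 = y" using two by (auto simp: field_simps)
    then show ?thesis using 4 by metis
  qed
next
  note two = two_neq_zero_odd_card[OF odd]
  assume h: "quad_char ((1 + s) / 2) = 1 \<and> quad_char ((1 - s) / 2) = -1"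
  have half: "1 - (1 + s) / 2 = (1 - s) / 2" using two by (simp add: field_simps)
  have "poly (g_poly s) ((1 + s) / 2) = of_int 1 * ((1 + s) / 2) + of_int (-1) * ((1 - s) / 2) - s"
    unfolding poly_g_poly[OF odd] half using h by (simp only:)
  also have "\<dots> = 0" using two four_neq_zero_odd_card[OF odd] by (simp add: field_simps)
  finally show "\<exists>y. poly (g_poly s) y = 0" by blast
qed

lemma quad_factor_root_iff:
  "eval_ac (quad_factor s w) y = 0 \<longleftrightarrow>
    y ^ 2 = to_ac (1 + s * w) * y - to_ac (((s + w) / 2) ^ 2)"
proof -
  have four: "((s + w) / 2) ^ 2 = (s + w) ^ 2 / 4" by (simp add: power_divide)
  have "eval_ac (quad_factor s w) y =
      y ^ 2 - (to_ac (1 + s * w) * y - to_ac (((s + w) / 2) ^ 2))"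
    unfolding four by (simp add: quad_factor_def power2_eq_square algebra_simps)
  then show ?thesis by simp
qed

text \<open>The discriminant of \<open>quad_factor s w\<close> is \<open>(1 - s\<^sup>2) (1 - w\<^sup>2)\<close>. Dividing each of the four linear
  terms by \<open>2\<close> does not change its character.\<close>

lemma quad_factor_root_base_field_iff:
  fixes y :: "'a::{field,finite} alg_closure"
  assumes odd: "odd CARD('a)" and root: "eval_ac (quad_factor s w) y = 0"
  shows "y \<notin> range to_ac \<longleftrightarrow>
    quad_char ((1 + s) / 2) * quad_char ((1 - s) / 2)
      * (quad_char ((1 + w) / 2) * quad_char ((1 - w) / 2)) = -1"
proof -
  note two = two_neq_zero_odd_card[OF odd]
  let ?D = "((1 + s) * (1 - s)) * ((1 + w) * (1 - w))"
  have two': "(2 :: 'a alg_closure) \<noteq> 0"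
    using two by (metis to_ac_eq_0_iff to_ac_numeral)
  have "(2 * y - to_ac (1 + s * w)) ^ 2
      = 4 * (y ^ 2 - to_ac (1 + s * w) * y) + to_ac ((1 + s * w) ^ 2)"
    by (simp add: power2_eq_square algebra_simps)
  also have "y ^ 2 - to_ac (1 + s * w) * y = - to_ac (((s + w) / 2) ^ 2)"
    using root unfolding quad_factor_root_iff by simp
  also have "4 * (- to_ac (((s + w) / 2) ^ 2)) + to_ac ((1 + s * w) ^ 2)
      = to_ac ((1 + s * w) ^ 2 - 4 * ((s + w) / 2) ^ 2)"
    by simp
  also have "4 * ((s + w) / 2) ^ 2 = (s + w) ^ 2"
    using four_neq_zero_odd_card[OF odd] by (simp add: power_divide)
  also have "(1 + s * w) ^ 2 - (s + w) ^ 2 = ?D"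
    by (simp add: power2_eq_square algebra_simps)
  finally have sq: "(2 * y - to_ac (1 + s * w)) ^ 2 = to_ac ?D" .
  have "y \<in> range to_ac \<longleftrightarrow> (\<exists>d. ?D = d ^ 2)"
  proof
    assume "y \<in> range to_ac"
    then obtain x where "y = to_ac x" by blast
    then have "to_ac ((2 * x - (1 + s * w)) ^ 2) = to_ac ?D" using sq by simp
    then show "\<exists>d. ?D = d ^ 2" by (metis to_ac_eq_iff)
  next
    assume "\<exists>d. ?D = d ^ 2"
    then obtain d where "?D = d ^ 2" by blast
    then have "(2 * y - to_ac (1 + s * w)) ^ 2 = to_ac d ^ 2" using sq by (metis to_ac_power)
    then have "2 * y - to_ac (1 + s * w) = to_ac d \<or> 2 * y - to_ac (1 + s * w) = - to_ac d"
      by (simp only: power2_eq_iff)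
    then have "y = to_ac ((1 + s * w + d) / 2) \<or> y = to_ac ((1 + s * w - d) / 2)"
      using two' by (auto simp: field_simps)
    then show "y \<in> range to_ac" by blast
  qed
  also have "\<dots> \<longleftrightarrow> quad_char ?D \<noteq> -1" by (simp add: quad_char_eq_neg_one_iff)
  also have "quad_char ?D = quad_char ((1 + s) / 2) * quad_char ((1 - s) / 2)
      * (quad_char ((1 + w) / 2) * quad_char ((1 - w) / 2))"
    by (simp only: quad_char_mult[OF odd, of "(1 + s) * (1 - s)"]
        quad_char_halves[OF odd, of "1 + s"] quad_char_halves[OF odd, of "1 + w"])
  finally show ?thesis by blast
qed

text \<open>This symmetry reduces every statement about \<open>(1 - y) ^ n\<close> to one about \<open>y ^ n\<close>.\<close>

lemma quad_factor_reflect: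
  fixes y :: "'a::{field,finite} alg_closure"
  assumes odd: "odd CARD('a)" and root: "eval_ac (quad_factor s w) y = 0"
  shows "eval_ac (quad_factor s (- w)) (1 - y) = 0"
proof -
  have "(4 :: 'a alg_closure) \<noteq> 0"
    using four_neq_zero_odd_card[OF odd] by (metis to_ac_eq_0_iff to_ac_numeral)
  then show ?thesis
    using root by (simp add: quad_factor_def field_simps power2_eq_square)
qed

lemma half_power_quad_factor_root:
  fixes y :: "'a::{field,finite} alg_closure"
  assumes odd: "odd CARD('a)" and card: "CARD('a) = CHAR('a) ^ k"
    and y: "y \<notin> range to_ac" and root: "eval_ac (quad_factor s w) y = 0"
  shows "y ^ ((CARD('a) + 1) div 2) = to_ac (of_int (quad_char ((1 + s) / 2)
    * quad_char ((1 + w) / 2)) * ((s + w) / 2))"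
proof -
  \<comment> \<open>The constant \<open>T + 2 a\<close> of the general formula, for trace \<open>T = 1 + s w\<close> and \<open>a = (s + w) / 2\<close>.\<close>
  have "1 + s * w + 2 * ((s + w) / 2) = (1 + s) * (1 + w)"
    using two_neq_zero_odd_card[OF odd] by (simp add: algebra_simps)
  then show ?thesis
    using half_power_of_square_norm[OF odd card y, of "1 + s * w" "(s + w) / 2"] root
    by (simp add: quad_factor_root_iff quad_char_halves[OF odd])
qed

lemma half_powers_quad_factor_root:
  fixes y :: "'a::{field,finite} alg_closure"
  assumes odd: "odd CARD('a)" and card: "CARD('a) = CHAR('a) ^ k"
    and y: "y \<notin> range to_ac" and root: "eval_ac (quad_factor s w) y = 0"
  shows "y ^ ((CARD('a) + 1) div 2) = to_ac (of_int (quad_char ((1 + s) / 2)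
      * quad_char ((1 + w) / 2)) * ((s + w) / 2))"
    and "(1 - y) ^ ((CARD('a) + 1) div 2) = to_ac (of_int (quad_char ((1 + s) / 2)
      * quad_char ((1 - w) / 2)) * ((s - w) / 2))"
proof -
  have "1 - y \<notin> range to_ac" using y by (simp add: one_minus_in_base_field_iff)
  from half_power_quad_factor_root[OF odd card this quad_factor_reflect[OF odd root]]
  show "(1 - y) ^ ((CARD('a) + 1) div 2) = to_ac (of_int (quad_char ((1 + s) / 2)
      * quad_char ((1 - w) / 2)) * ((s - w) / 2))"
    by simp
qed (rule half_power_quad_factor_root[OF assms])

lemma half_power_square_norm:
  fixes y :: "'a::{field,finite} alg_closure"
  assumes odd: "odd CARD('a)" and card: "CARD('a) = CHAR('a) ^ k"
    and y: "y \<notin> range to_ac" and root: "y ^ 2 = to_ac T * y - to_ac N"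
  shows "(y ^ ((CARD('a) + 1) div 2)) ^ 2 = to_ac N"
proof -
  have "(CARD('a) + 1) div 2 * 2 = Suc CARD('a)" using odd by presburger
  then have "(y ^ ((CARD('a) + 1) div 2)) ^ 2 = y * y ^ CARD('a)"
    by (metis power_Suc power_mult)
  also have "\<dots> = y * (to_ac T - y)"
    by (simp add: frobenius_quadratic_root[OF card y root])
  also have "\<dots> = to_ac N"
    using root by (simp add: power2_eq_square algebra_simps)
  finally show ?thesis .
qed

text \<open>With \<open>a = y ^ n\<close> and \<open>b = (1 - y) ^ n\<close>, both \<open>a\<^sup>2\<close> and \<open>b\<^sup>2\<close> are norms, with
  \<open>b\<^sup>2 - a\<^sup>2 = 1 - T\<close> for the trace \<open>T\<close> of \<open>y\<close>. Together with \<open>a + b = s \<noteq> 0\<close> this makes \<open>a\<close>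
  and \<open>b\<close> elements of the base field, and \<open>w\<close> is their difference.\<close>

lemma g_poly_quadratic_root_imp_quad_factor_root:
  fixes y :: "'a::{field,finite} alg_closure"
  assumes odd: "odd CARD('a)" and card: "CARD('a) = CHAR('a) ^ k" and s: "s \<noteq> 0"
    and y: "y \<notin> range to_ac" and root: "y ^ 2 = to_ac T * y - to_ac N"
    and g: "eval_ac (g_poly s) y = 0"
  obtains w where "eval_ac (quad_factor s w) y = 0"
    and "y ^ ((CARD('a) + 1) div 2) = to_ac ((s + w) / 2)"
    and "(1 - y) ^ ((CARD('a) + 1) div 2) = to_ac ((s - w) / 2)"
proof -
  note two = two_neq_zero_odd_card[OF odd]
  define a where "a = y ^ ((CARD('a) + 1) div 2)"
  define b where "b = (1 - y) ^ ((CARD('a) + 1) div 2)"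
  define w where "w = (T - 1) / s"
  have T: "T = 1 + s * w" using s by (simp add: w_def)
  have b: "b = to_ac s - a"
    using g by (simp add: eval_ac_g_poly a_def b_def algebra_simps)
  have a2: "a ^ 2 = to_ac N"
    unfolding a_def by (rule half_power_square_norm[OF odd card y root])
  have "1 - y \<notin> range to_ac" using y by (simp add: one_minus_in_base_field_iff)
  moreover have "(1 - y) ^ 2 = to_ac (2 - T) * (1 - y) - to_ac (1 - T + N)"
    using root by (simp add: power2_eq_square algebra_simps)
  ultimately have "b ^ 2 = to_ac (1 - T + N)"
    unfolding b_def by (rule half_power_square_norm[OF odd card])
  then have "b ^ 2 - a ^ 2 = to_ac (1 - T)" by (simp add: a2)
  then have "to_ac s * (2 * a) = to_ac s * to_ac (s + w)"
    by (simp add: b T power2_eq_square algebra_simps)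
  then have "2 * a = to_ac (s + w)" using s by simp
  moreover have "(2 :: 'a alg_closure) \<noteq> 0"
    using two by (metis to_ac_eq_0_iff to_ac_numeral)
  ultimately have a: "a = to_ac ((s + w) / 2)" by (simp add: field_simps)
  have "s - (s + w) / 2 = (s - w) / 2" using two by (simp add: field_simps)
  then have b': "b = to_ac ((s - w) / 2)" unfolding b a by (metis to_ac_diff)
  have "to_ac N = to_ac (((s + w) / 2) ^ 2)" using a2 a by simp
  then have "eval_ac (quad_factor s w) y = 0"
    unfolding quad_factor_root_iff using root T by simp
  then show ?thesis using that a b' by (simp add: a_def b_def)
qed

lemma g_poly_neq_zero:
  assumes "s \<noteq> 1"
  shows "g_poly s \<noteq> 0"
proof -
  have "poly (g_poly s) 0 = 1 - s" by (simp add: g_poly_def Let_def)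
  then show ?thesis using assms by auto
qed

text \<open>Neither \<open>y ^ n\<close> nor \<open>(1 - y) ^ n\<close> vanishes, so comparing their two expressions in terms of
  \<open>w\<close> gives \<open>\<rho>(1 + w) = \<rho>(1 - w) = \<rho>(1 + s)\<close>; since \<open>(1 - s\<^sup>2) (1 - w\<^sup>2)\<close> is a non-square,
  \<open>\<rho>(1 - s)\<close> has the opposite value.\<close>

lemma g_poly_degree_two_root_imp_opposite_chars:
  fixes s :: "'a::{field,finite}"
  assumes odd: "odd CARD('a)" and card: "CARD('a) = CHAR('a) ^ k" and s: "s \<notin> {0, 1}"
    and g: "eval_ac (g_poly s) y = 0" and deg: "degree_over y = 2"
  shows "quad_char ((1 + s) / 2) * quad_char ((1 - s) / 2) = -1"
proof -
  have "g_poly s \<noteq> 0" using g_poly_neq_zero s by blast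
  then obtain c b where cb: "eval_ac [:c, b, 1:] y = 0" and y: "y \<notin> range to_ac"
    using degree_over_eq_2E[OF _ g deg] by blast
  have root: "y ^ 2 = to_ac (- b) * y - to_ac c"
    using cb by (simp add: power2_eq_square algebra_simps eq_neg_iff_add_eq_0)
  obtain w where w: "eval_ac (quad_factor s w) y = 0"
    "y ^ ((CARD('a) + 1) div 2) = to_ac ((s + w) / 2)"
    "(1 - y) ^ ((CARD('a) + 1) div 2) = to_ac ((s - w) / 2)"
    using g_poly_quadratic_root_imp_quad_factor_root[OF odd card _ y root g] s by blast
  have "y \<noteq> to_ac 0" "y \<noteq> to_ac 1" using y by blast+
  then have "y ^ ((CARD('a) + 1) div 2) \<noteq> 0" "(1 - y) ^ ((CARD('a) + 1) div 2) \<noteq> 0"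
    by (auto simp del: power_Suc)
  then have nz: "(s + w) / 2 \<noteq> 0" "(s - w) / 2 \<noteq> 0" unfolding w(2,3) by (metis to_ac_0)+
  have sign: "e = 1" if "e \<in> {-1, 0, 1}" and "x = of_int e * x" and "x \<noteq> 0" for e and x :: 'a
    by (rule of_int_sign_eq_iff[OF odd that(1)]) (use that(2,3) in auto)
  have mem: "quad_char u * quad_char v \<in> {-1, 0, 1}" for u v :: 'a
    using quad_char_cases[of u] quad_char_cases[of v] by auto
  note hp = half_powers_quad_factor_root[OF odd card y w(1)]
  have "quad_char ((1 + s) / 2) * quad_char ((1 + w) / 2) = 1"
    by (rule sign[OF mem _ nz(1)]) (use hp(1) w(2) in \<open>metis to_ac_eq_iff\<close>)
  moreover have "quad_char ((1 + s) / 2) * quad_char ((1 - w) / 2) = 1"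
    by (rule sign[OF mem _ nz(2)]) (use hp(2) w(3) in \<open>metis to_ac_eq_iff\<close>)
  moreover have "quad_char ((1 + s) / 2) * quad_char ((1 - s) / 2)
      * (quad_char ((1 + w) / 2) * quad_char ((1 - w) / 2)) = -1"
    using quad_factor_root_base_field_iff[OF odd w(1)] y by blast
  moreover have "e\<^sub>1 * e\<^sub>2 = -1"
    if "e\<^sub>1 * f\<^sub>1 = 1" "e\<^sub>1 * f\<^sub>2 = 1" "e\<^sub>1 * e\<^sub>2 * (f\<^sub>1 * f\<^sub>2) = -1" for e\<^sub>1 e\<^sub>2 f\<^sub>1 f\<^sub>2 :: int
  proof -
    have "e\<^sub>1 = 1 \<and> f\<^sub>1 = 1 \<or> e\<^sub>1 = -1 \<and> f\<^sub>1 = -1"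
      using that(1) by (simp add: zmult_eq_1_iff)
    then show ?thesis using that(2,3) by auto
  qed
  ultimately show ?thesis by blast
qed

lemma quad_factor_root_exists:
  obtains y where "eval_ac (quad_factor s w) y = 0"
proof -
  have "degree (map_poly to_ac (quad_factor s w)) = degree (quad_factor s w)"
    by (rule degree_map_poly) simp
  then show ?thesis
    using alg_closed_imp_poly_has_root[of "map_poly to_ac (quad_factor s w)"] that
    by (auto simp: quad_factor_def)
qed

lemma quad_factor_root_is_g_poly_root:
  fixes y :: "'a::{field,finite} alg_closure"
  assumes odd: "odd CARD('a)" and card: "CARD('a) = CHAR('a) ^ k"
    and s: "quad_char ((1 + s) / 2) = -1" "quad_char ((1 - s) / 2) = 1"
    and w: "quad_char ((1 + w) / 2) = -1" "quad_char ((1 - w) / 2) = -1"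
    and root: "eval_ac (quad_factor s w) y = 0"
  shows "y \<notin> range to_ac" and "eval_ac (g_poly s) y = 0"
proof -
  show y: "y \<notin> range to_ac"
    by (simp add: quad_factor_root_base_field_iff[OF odd root] s w)
  have "(s + w) / 2 + (s - w) / 2 - s = 0"
    using two_neq_zero_odd_card[OF odd] by (simp add: field_simps)
  then have "to_ac ((s + w) / 2) + to_ac ((s - w) / 2) - to_ac s = 0"
    by (metis to_ac_0 to_ac_add to_ac_diff)
  then show "eval_ac (g_poly s) y = 0"
    unfolding eval_ac_g_poly half_powers_quad_factor_root[OF odd card y root] by (simp add: s w)
qed

section \<open>The factorization\<close>

lemma prod_prime_elems_dvd:
  fixes f :: "'i \<Rightarrow> 'b::idom"
  assumes "finite W" and "\<And>w. w \<in> W \<Longrightarrow> prime_elem (f w)" and "\<And>w. w \<in> W \<Longrightarrow> f w dvd g"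
    and "\<And>v w. v \<in> W \<Longrightarrow> w \<in> W \<Longrightarrow> f v dvd f w \<Longrightarrow> v = w"
  shows "prod f W dvd g"
  using assms
proof (induction W rule: finite_induct)
  case (insert v W)
  then obtain h where h: "g = prod f W * h" by (auto elim!: dvdE)
  have p: "prime_elem (f v)" and "f v dvd prod f W * h" using insert.prems h by auto
  moreover have "\<not> f v dvd prod f W"
  proof
    assume "f v dvd prod f W"
    moreover have "\<exists>w\<in>U. f v dvd f w" if "finite U" "f v dvd prod f U" for U
      using that
    proof (induction U rule: finite_induct)
      case empty
      then show ?case using p by (simp add: prime_elem_not_unit)
    next
      case (insert u U)
      then show ?case using prime_elem_dvd_multD[OF p, of "f u" "prod f U"] by auto
    qed
    ultimately obtain w where "w \<in> W" "f v dvd f w" using insert.hyps by blast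
    then show False using insert.prems(3)[of v w] insert.hyps by auto
  qed
  ultimately have "f v dvd h" using prime_elem_dvd_multD by blast
  then show ?case using insert.hyps h by (simp add: mult.commute mult_dvd_mono)
qed simp

lemma quad_factor_dvd_imp_eq:
  assumes "s \<noteq> 0" and "quad_factor s v dvd quad_factor s w"
  shows "v = w"
proof -
  obtain h where h: "quad_factor s w = quad_factor s v * h" using assms(2) by (elim dvdE)
  have deg: "degree (quad_factor s u) = 2" for u by (simp add: quad_factor_def)
  have nz: "quad_factor s u \<noteq> 0" for u by (simp add: quad_factor_def)
  then have "h \<noteq> 0" using h by auto
  then have "degree h = 0" using h degree_mult_eq[OF nz \<open>h \<noteq> 0\<close>, of v] deg[of w] deg[of v] by simp
  then obtain c where c: "h = [:c:]" by (elim degree_eq_zeroE)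
  then have "c = 1" using h by (simp add: quad_factor_def)
  then have "s * w = s * v" using h c by (simp add: quad_factor_def)
  then show ?thesis using assms(1) by simp
qed

text \<open>Let \<open>n = (q + 1) / 2\<close>. For \<open>q \<equiv> 3\<close> modulo \<open>4\<close>, \<open>n\<close> is even and the two powers contribute
  \<open>2 y ^ n\<close>. For \<open>q \<equiv> 1\<close> modulo \<open>4\<close>, \<open>n\<close> is odd, the terms of degree \<open>n\<close> cancel, and the next
  coefficient is \<open>n\<close>, which is \<open>1 / 2\<close> in the field.\<close>

lemma g_poly_degree_and_coeff:
  fixes s :: "'a::{field,finite}"
  assumes odd: "odd CARD('a)"
    and d: "2 * int d = int CARD('a) - quad_char (-1 :: 'a)"
  shows "degree (g_poly s) \<le> d"
    and "coeff (g_poly s) d = of_nat (tau CARD('a)) ^ 2 / 2"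
proof -
  note two = two_neq_zero_odd_card[OF odd]
  define n where "n = (CARD('a) + 1) div 2"
  have n2: "2 * n = CARD('a) + 1" using odd by (simp add: n_def)
  have "2 \<le> CARD('a)" using card_mono[of "UNIV :: 'a set" "{0, 1}"] by simp
  then have q3: "3 \<le> CARD('a)" using odd by presburger
  have coeff: "coeff (g_poly s) i
      = (if i = n then 1 else 0) + (if i \<le> n then of_nat (n choose i) * (-1) ^ i else 0)"
    if "i > 0" for i
  proof -
    have "coeff ([:1, -1 :: 'a:] ^ n) i = (if i \<le> n then of_nat (n choose i) * (-1) ^ i else 0)"
    proof (cases "i \<le> n")
      case False
      have "degree ([:1, -1 :: 'a:] ^ n) \<le> n" using degree_power_le[of "[:1, -1 :: 'a:]" n] by simp
      then show ?thesis using False by (simp add: coeff_eq_0)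
    qed (simp add: coeff_linear_poly_power)
    moreover have "[:0, 1 :: 'a:] ^ n = monom 1 n" by (simp add: monom_altdef)
    ultimately show ?thesis
      using that unfolding g_poly_def Let_def n_def[symmetric]
      by (cases i) (simp_all add: coeff_pCons)
  qed
  have "degree (g_poly s) \<le> d \<and> coeff (g_poly s) d = of_nat (tau CARD('a)) ^ 2 / 2"
  proof (cases "CARD('a) mod 4 = 1")
    case True
    then have "2 * int d = int CARD('a) - 1" using d by (simp add: quad_char_minus_one[OF odd])
    then have n: "n = Suc d" and d0: "d > 0" using n2 q3 by linarith+
    have "even d" using True n2 n by presburger
    have "degree (g_poly s) \<le> d"
    proof (rule degree_le, intro allI impI)
      fix i assume "d < i"
      then show "coeff (g_poly s) i = 0"
        using n \<open>even d\<close> by (cases "i = Suc d") (auto simp: coeff)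
    qed
    moreover have "coeff (g_poly s) d = of_nat n"
      using d0 n \<open>even d\<close> by (simp add: coeff)
    moreover have "of_nat n = (1 / 2 :: 'a)"
    proof -
      have "of_nat CARD('a) = (0 :: 'a)"
        by (simp add: of_nat_eq_0_iff_char_dvd CHAR_dvd_CARD)
      then have "of_nat (2 * n) = (1 :: 'a)" unfolding n2 by simp
      then have "2 * of_nat n = (1 :: 'a)" by simp
      then show ?thesis using two by (simp add: field_simps)
    qed
    ultimately show ?thesis using True by (simp add: tau_def)
  next
    case False
    then have "2 * int d = int CARD('a) + 1" using d by (simp add: quad_char_minus_one[OF odd])
    then have n: "n = d" and d0: "d > 0" using n2 q3 by linarith+
    have "even d" using False n2 n by presburger
    have "degree (g_poly s) \<le> d"
      by (rule degree_le) (use n in \<open>auto simp: coeff\<close>)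
    moreover have "coeff (g_poly s) d = 2"
      using d0 n \<open>even d\<close> by (simp add: coeff)
    ultimately show ?thesis using False two by (simp add: tau_def power2_eq_square)
  qed
  then show "degree (g_poly s) \<le> d" "coeff (g_poly s) d = of_nat (tau CARD('a)) ^ 2 / 2"
    by auto
qed

lemma quad_factor_prime_elem:
  fixes s :: "'a::{field,finite}"
  assumes odd: "odd CARD('a)" and card: "CARD('a) = CHAR('a) ^ k"
    and s: "quad_char ((1 + s) / 2) = -1" "quad_char ((1 - s) / 2) = 1"
    and w: "quad_char ((1 + w) / 2) = -1" "quad_char ((1 - w) / 2) = -1"
  shows "prime_elem (quad_factor s w)" and "quad_factor s w dvd g_poly s"
proof -
  obtain y where root: "eval_ac (quad_factor s w) y = 0" by (rule quad_factor_root_exists)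
  note y = quad_factor_root_is_g_poly_root[OF odd card s w root]
  show "prime_elem (quad_factor s w)"
    using quadratic_root_prime_elem[OF y(1)] root unfolding quad_factor_def by blast
  show "quad_factor s w dvd g_poly s"
    using quadratic_root_eval_zero_iff[OF y(1)] root y(2) unfolding quad_factor_def by blast
qed

text \<open>The product divides \<open>g\<^sub>s\<close>, and by the count of the \<open>w\<close> it already has the degree of \<open>g\<^sub>s\<close>.\<close>

lemma g_poly_factorization:
  fixes s :: "'a::{field,finite}"
  assumes odd: "odd CARD('a)" and card: "CARD('a) = CHAR('a) ^ k" and s01: "s \<notin> {0, 1}"
    and s: "quad_char ((1 + s) / 2) = -1" "quad_char ((1 - s) / 2) = 1"
  shows "g_poly s = smult (of_nat (tau CARD('a)) ^ 2 / 2)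
    (\<Prod>w | quad_char ((1 + w) / 2) = -1 \<and> quad_char ((1 - w) / 2) = -1. quad_factor s w)"
proof -
  let ?W = "{w :: 'a. quad_char ((1 + w) / 2) = -1 \<and> quad_char ((1 - w) / 2) = -1}"
  define P where "P = prod (quad_factor s) ?W"
  define d where "d = 2 * card ?W"
  have "2 * int d = int CARD('a) - quad_char (-1 :: 'a)"
    using card_nonsquare_pairs_sum_one[OF odd] by (simp add: d_def)
  note g = g_poly_degree_and_coeff[OF odd this, of s]
  have "P dvd g_poly s"
    unfolding P_def
    by (rule prod_prime_elems_dvd)
      (use quad_factor_prime_elem[OF odd card s] quad_factor_dvd_imp_eq s01 in auto)
  then obtain h where h: "g_poly s = P * h" by (elim dvdE)
  have qf: "degree (quad_factor s w) = 2" "lead_coeff (quad_factor s w) = 1"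
    "quad_factor s w \<noteq> 0" for w
    by (auto simp: quad_factor_def)
  have degP: "degree P = d"
    by (simp add: P_def d_def degree_prod_sum_eq qf)
  have lcP: "lead_coeff P = 1" unfolding P_def lead_coeff_prod by (simp only: qf(2) prod.neutral_const)
  have "P \<noteq> 0" "h \<noteq> 0" using lcP h g_poly_neq_zero[of s] s01 by auto
  then have "degree h = 0" using degree_mult_eq[of P h] degP g(1) h by simp
  then obtain c where c: "h = [:c:]" by (elim degree_eq_zeroE)
  then have gP: "g_poly s = smult c P" using h by simp
  have "coeff (g_poly s) d = c" unfolding gP using lcP degP by simp
  then show ?thesis using gP g(2) unfolding P_def by metis
qed

theorem theorem2p3:
  fixes s :: "'a::{field,finite}" and p k :: nat
  assumes "prime p" and "odd p" and "k \<ge> 1" and "CARD('a) = p ^ k"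
    and "s \<notin> {0, 1, -1}"
  shows "((quad_char ((1 + s) / 2) = -1 \<and> quad_char ((1 - s) / 2) = 1) \<longleftrightarrow>
            (\<not> (\<exists>y::'a. poly (g_poly s) y = 0) \<and>
             (\<exists>y::'a alg_closure. poly (map_poly to_ac (g_poly s)) y = 0 \<and> degree_over y = 2)))
       \<and> ((quad_char ((1 + s) / 2) = -1 \<and> quad_char ((1 - s) / 2) = 1) \<longrightarrow>
            g_poly s = smult (of_nat (tau CARD('a)) ^ 2 / 2)
              (\<Prod>w | quad_char ((1 + w) / 2) = -1 \<and> quad_char ((1 - w) / 2) = -1. quad_factor s w)
          \<and> (\<forall>w. quad_char ((1 + w) / 2) = -1 \<and> quad_char ((1 - w) / 2) = -1 \<longrightarrow>
                 irreducible (quad_factor s w)))"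
proof -
  let ?star = "quad_char ((1 + s) / 2) = -1 \<and> quad_char ((1 - s) / 2) = 1"
  let ?deg2 = "\<exists>y::'a alg_closure. eval_ac (g_poly s) y = 0 \<and> degree_over y = 2"
  have odd: "odd CARD('a)" using assms by simp
  have "prime CHAR('a)" by (simp add: prime_CHAR_semidom finite_imp_CHAR_pos)
  moreover have "CHAR('a) dvd p ^ k" using CHAR_dvd_CARD[where 'a='a] assms(4) by simp
  ultimately have "CHAR('a) = p"
    using assms(1) prime_dvd_power primes_dvd_imp_eq by blast
  then have card: "CARD('a) = CHAR('a) ^ k" using assms(4) by simp
  have s: "s \<notin> {0, 1}" using assms(5) by auto
  have base: "(\<exists>y. poly (g_poly s) y = 0) \<longleftrightarrow>
      quad_char ((1 + s) / 2) = 1 \<and> quad_char ((1 - s) / 2) = -1"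
    by (rule g_poly_root_base_field_iff[OF odd assms(5)])
  have "?deg2" if star: "?star"
  proof -
    have "2 \<le> CARD('a)" using card_mono[of "UNIV :: 'a set" "{0, 1}"] by simp
    then have "0 < 4 * int (card {w :: 'a. quad_char ((1 + w) / 2) = -1 \<and> quad_char ((1 - w) / 2) = -1})"
      using card_nonsquare_pairs_sum_one[OF odd] quad_char_cases[of "-1 :: 'a"] by auto
    then obtain w :: 'a where w: "quad_char ((1 + w) / 2) = -1" "quad_char ((1 - w) / 2) = -1"
      by (auto simp: card_gt_0_iff)
    obtain y where root: "eval_ac (quad_factor s w) y = 0" by (rule quad_factor_root_exists)
    note y = quad_factor_root_is_g_poly_root[OF odd card _ _ w root]
    have "degree_over y = 2"
      using degree_over_quadratic_root[OF y(1)] root star unfolding quad_factor_def by blast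
    then show ?thesis using y(2) star by blast
  qed
  moreover have "?star" if "\<not> (\<exists>y. poly (g_poly s) y = 0)" and ?deg2
  proof -
    have "quad_char ((1 + s) / 2) * quad_char ((1 - s) / 2) = -1"
      using that(2) g_poly_degree_two_root_imp_opposite_chars[OF odd card s] by blast
    then show ?thesis
      using that(1) quad_char_cases[of "(1 + s) / 2"] quad_char_cases[of "(1 - s) / 2"]
      unfolding base by (elim insertE) simp_all
  qed
  moreover have "\<not> (\<exists>y. poly (g_poly s) y = 0)" if "?star" using that unfolding base by simp
  moreover have "g_poly s = smult (of_nat (tau CARD('a)) ^ 2 / 2)
      (\<Prod>w | quad_char ((1 + w) / 2) = -1 \<and> quad_char ((1 - w) / 2) = -1. quad_factor s w)"
    if "?star"
    using g_poly_factorization[OF odd card s] that by blast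
  moreover have "irreducible (quad_factor s w)"
    if "?star" "quad_char ((1 + w) / 2) = -1" "quad_char ((1 - w) / 2) = -1" for w
    using quad_factor_prime_elem(1)[OF odd card] that prime_elem_imp_irreducible by blast
  ultimately show ?thesis by blast
qed

end
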